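(* Let $N\ge1$, $X\in\mathbb{R}^{n\times d}$, $Y\in\mathbb{R}^{m\times d}$, let $\sigma_1,\dots,\sigma_N:\mathbb{R}\to\mathbb{R}$ be differentiable, and for $W_0\in\mathbb{R}^{r_0\times n}$, $W_j\in\mathbb{R}^{r_j\times r_{j-1}}$ ($1\le j\le N-1$), $W_N\in\mathbb{R}^{m\times r_{N-1}}$ let $$F(W_0,\dots,W_N)=\tfrac12\big\|Y-W_N\sigma_N(W_{N-1}\sigma_{N-1}(\cdots\sigma_1(W_0X)\cdots))\big\|_F^2.$$ If the weights $[W_0,\dots,W_{N-1}]$ satisfy $$\sigma_N(W_{N-1}\sigma_{N-1}(\cdots\sigma_1(W_0X)\cdots))=0\quad\text{and}\quad\sigma_N'(W_{N-1}\sigma_{N-1}(\cdots\sigma_1(W_0X)\cdots))=0,$$ then $(W_0,\dots,W_{N-1},W_N)$ is a first order stationary point of $F$ for any $W_N$.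
   Context: Each $\sigma_j$ and its derivative $\sigma_j'$ are applied to matrices elementwise. $\|\cdot\|_F$ is the Frobenius norm. A first order stationary point of $F$ is a point where $\nabla F=0$. *)

theory Defs
  imports "HOL-Analysis.Derivative" "Jordan_Normal_Form.Matrix"
begin

definition frobenius_inner :: "real mat \<Rightarrow> real mat \<Rightarrow> real" where
  "frobenius_inner A B = (\<Sum>i<dim_row A. \<Sum>k<dim_col A. A $$ (i, k) * B $$ (i, k))"

definition frobenius_norm :: "real mat \<Rightarrow> real" where
  "frobenius_norm A = sqrt (\<Sum>i<dim_row A. \<Sum>k<dim_col A. (A $$ (i, k))\<^sup>2)"

text \<open>
  A tuple of weights \<open>(W\<^sub>0, \<dots>, W\<^sub>N)\<close> is a function \<open>W\<close> on \<open>nat\<close>; its values above \<open>N\<close> are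
  irrelevant. \<open>W\<^sub>j\<close> has \<open>r j\<close> rows for \<open>j < N\<close>, and \<open>W\<^sub>N\<close> has \<open>m\<close> rows.
\<close>

definition weight_space :: "nat \<Rightarrow> nat \<Rightarrow> nat \<Rightarrow> (nat \<Rightarrow> nat) \<Rightarrow> (nat \<Rightarrow> real mat) set" where
  "weight_space N n m r = {W. W 0 \<in> carrier_mat (r 0) n \<and>
     (\<forall>j\<in>{1..N-1}. W j \<in> carrier_mat (r j) (r (j-1))) \<and>
     W N \<in> carrier_mat m (r (N-1))}"

text \<open>
  \<open>pre_activation \<sigma> X W j\<close> is \<open>W\<^sub>j \<sigma>\<^sub>j(W\<^bsub>j-1\<^esub> \<sigma>\<^bsub>j-1\<^esub>(\<dots> \<sigma>\<^sub>1(W\<^sub>0 X) \<dots>))\<close>.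
\<close>

fun pre_activation ::
  "(nat \<Rightarrow> real \<Rightarrow> real) \<Rightarrow> real mat \<Rightarrow> (nat \<Rightarrow> real mat) \<Rightarrow> nat \<Rightarrow> real mat" where
  "pre_activation \<sigma> X W 0 = W 0 * X"
| "pre_activation \<sigma> X W (Suc j) = W (Suc j) * map_mat (\<sigma> (Suc j)) (pre_activation \<sigma> X W j)"

definition network_loss ::
  "nat \<Rightarrow> (nat \<Rightarrow> real \<Rightarrow> real) \<Rightarrow> real mat \<Rightarrow> real mat \<Rightarrow> (nat \<Rightarrow> real mat) \<Rightarrow> real" where
  "network_loss N \<sigma> X Y W =
     1/2 * (frobenius_norm (Y - W N * map_mat (\<sigma> N) (pre_activation \<sigma> X W (N-1))))\<^sup>2"

definition weights_inner :: "nat \<Rightarrow> (nat \<Rightarrow> real mat) \<Rightarrow> (nat \<Rightarrow> real mat) \<Rightarrow> real" where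
  "weights_inner N G H = (\<Sum>j\<le>N. frobenius_inner (G j) (H j))"

definition weights_norm :: "nat \<Rightarrow> (nat \<Rightarrow> real mat) \<Rightarrow> real" where
  "weights_norm N H = sqrt (weights_inner N H H)"

text \<open>
  The weight space depends on the numbers \<open>N, n, m, r j\<close> and so is not a type of class
  \<open>real_inner\<close>; the following is the definition of \<open>gderiv\<close> (Frechet differentiability, with the
  derivative represented by \<open>G\<close> through the inner product) spelled out on that space.
\<close>

definition has_gradient ::
  "nat \<Rightarrow> (nat \<Rightarrow> real mat) set \<Rightarrow> ((nat \<Rightarrow> real mat) \<Rightarrow> real) \<Rightarrow>
   (nat \<Rightarrow> real mat) \<Rightarrow> (nat \<Rightarrow> real mat) \<Rightarrow> bool" where
  "has_gradient N V F W G \<longleftrightarrow>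
     (\<forall>\<epsilon>>0. \<exists>\<delta>>0. \<forall>H\<in>V. weights_norm N H < \<delta> \<longrightarrow>
        \<bar>F (\<lambda>j. W j + H j) - F W - weights_inner N G H\<bar> \<le> \<epsilon> * weights_norm N H)"

definition first_order_stationary ::
  "nat \<Rightarrow> (nat \<Rightarrow> real mat) set \<Rightarrow> ((nat \<Rightarrow> real mat) \<Rightarrow> real) \<Rightarrow> (nat \<Rightarrow> real mat) \<Rightarrow> bool" where
  "first_order_stationary N V F W \<longleftrightarrow>
     W \<in> V \<and> has_gradient N V F W (\<lambda>j. 0\<^sub>m (dim_row (W j)) (dim_col (W j)))"

text \<open>
  Consistency with partial derivatives: the entries of \<open>G\<close> are the partial derivatives of \<open>F\<close>
  at \<open>W\<close>; in particular \<open>G\<close> is unique.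
\<close>

lemma has_gradient_imp_partial_derivative:
  fixes W :: "nat \<Rightarrow> real mat"
  defines "E \<equiv> \<lambda>j a b t. Matrix.mat (dim_row (W j)) (dim_col (W j))
                    (\<lambda>p. if p = (a, b) then t else (0::real))"
  assumes W: "W \<in> weight_space N n m r" and G: "G \<in> weight_space N n m r"
    and grad: "has_gradient N (weight_space N n m r) F W G"
    and "1 \<le> N" and j: "j \<le> N" and a: "a < dim_row (W j)" and b: "b < dim_col (W j)"
  shows "((\<lambda>t. F (W(j := W j + E j a b t))) has_real_derivative G j $$ (a, b)) (at 0)"
proof -
  let ?V = "weight_space N n m r"
  define H where "H = (\<lambda>t k. if k = j then E j a b t else 0\<^sub>m (dim_row (W k)) (dim_col (W k)))"
  have dims: "dim_row (G k) = dim_row (W k) \<and> dim_col (G k) = dim_col (W k)" if kN: "k \<le> N" for k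
  proof -
    consider "k = 0" | "k = N" | "k \<in> {1..N-1}" using kN by (cases "k = 0"; cases "k = N") auto
    then have "\<exists>p q. W k \<in> carrier_mat p q \<and> G k \<in> carrier_mat p q"
      using W G unfolding weight_space_def by cases blast+
    then show ?thesis by auto
  qed
  have HV: "H t \<in> ?V" for t
    using W by (auto simp: weight_space_def H_def E_def)
  have add: "(\<lambda>k. W k + H t k) = W(j := W j + E j a b t)" for t
    by (auto simp: H_def fun_eq_iff intro!: eq_matI)
  have delta: "(\<Sum>i<p. \<Sum>k<q. if i = a \<and> k = b then c else 0) = c"
    if "a < p" "b < q" for p q :: nat and c :: real
  proof -
    have "(\<Sum>i<p. \<Sum>k<q. if i = a \<and> k = b then c else 0)
        = (\<Sum>i<p. if i = a then (\<Sum>k<q. if k = b then c else 0) else 0)"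
      by (intro sum.cong) auto
    then show ?thesis using that by simp
  qed
  have only_j: "weights_inner N G' (H t) = frobenius_inner (G' j) (E j a b t)"
    if "\<And>k. k \<le> N \<Longrightarrow> dim_row (G' k) = dim_row (W k) \<and> dim_col (G' k) = dim_col (W k)" for G' t
  proof -
    have "weights_inner N G' (H t) = (\<Sum>k\<le>N. if k = j then frobenius_inner (G' j) (E j a b t) else 0)"
      unfolding weights_inner_def
      by (intro sum.cong) (auto simp: H_def frobenius_inner_def that)
    then show ?thesis using j by simp
  qed
  have inner: "weights_inner N G (H t) = G j $$ (a, b) * t" for t
  proof -
    have "frobenius_inner (G j) (E j a b t) =
        (\<Sum>i<dim_row (W j). \<Sum>k<dim_col (W j). if i = a \<and> k = b then G j $$ (a, b) * t else 0)"
      unfolding frobenius_inner_def using dims[OF j]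
      by (intro sum.cong) (auto simp: E_def)
    then show ?thesis using only_j[OF dims] delta[OF a b] by simp
  qed
  have norm: "weights_norm N (H t) = \<bar>t\<bar>" for t
  proof -
    have "frobenius_inner (E j a b t) (E j a b t) =
        (\<Sum>i<dim_row (W j). \<Sum>k<dim_col (W j). if i = a \<and> k = b then t * t else 0)"
      unfolding frobenius_inner_def
      by (intro sum.cong) (auto simp: E_def)
    moreover have "weights_inner N (H t) (H t) = frobenius_inner (H t j) (E j a b t)"
      by (rule only_j) (auto simp: H_def E_def)
    ultimately show ?thesis using delta[OF a b] by (simp add: weights_norm_def H_def)
  qed
  let ?f = "\<lambda>t. F (W(j := W j + E j a b t))"
  have f0: "?f 0 = F W"
  proof -
    have "W j + E j a b 0 = W j" by (rule eq_matI) (auto simp: E_def)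
    then show ?thesis by simp
  qed
  have "(?f has_derivative (\<lambda>t. G j $$ (a, b) * t)) (at 0)"
    unfolding has_derivative_at_alt
  proof (intro conjI allI impI)
    show "bounded_linear (\<lambda>t. G j $$ (a, b) * t)" by (rule bounded_linear_mult_right)
    fix e :: real assume "e > 0"
    then obtain d where "d > 0" and d: "\<And>K. K \<in> ?V \<Longrightarrow> weights_norm N K < d \<Longrightarrow>
        \<bar>F (\<lambda>j. W j + K j) - F W - weights_inner N G K\<bar> \<le> e * weights_norm N K"
      using grad unfolding has_gradient_def by meson
    show "\<exists>d>0. \<forall>y. norm (y - 0) < d \<longrightarrow>
        norm (?f y - ?f 0 - G j $$ (a, b) * (y - 0)) \<le> e * norm (y - 0)"
      using \<open>d > 0\<close> d[OF HV] by (intro exI[of _ d]) (simp add: add norm inner f0)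
  qed
  then show ?thesis by (simp add: has_field_derivative_def)
qed

end

theory Submission
  imports Defs "HOL-Library.Landau_Symbols"
begin

text \<open>
  Perturb the weights by \<open>H\<close>. Since every \<open>\<sigma>\<^sub>j\<close> is differentiable, the argument of \<open>\<sigma>\<^sub>N\<close> moves by
  \<open>O(\<parallel>H\<parallel>)\<close>. As \<open>\<sigma>\<^sub>N\<close> and its derivative vanish at the unperturbed argument, the last hidden layer,
  and with it the network output, is \<open>o(\<parallel>H\<parallel>)\<close>. The residual thus changes from \<open>Y\<close> to
  \<open>Y - o(\<parallel>H\<parallel>)\<close>, and the loss by \<open>o(\<parallel>H\<parallel>)\<close>.
\<close>

section \<open>Small weight perturbations as a filter\<close>

text \<open>Weight tuples of fixed shapes form a set and not a topological type, so the
  neighbourhoods of zero inside \<open>V\<close> are built by hand; Landau symbols can then be taken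
  along this filter. Perturbations of norm 0 are kept, as in \<open>has_gradient\<close>.\<close>

definition weights_at_zero :: "nat \<Rightarrow> (nat \<Rightarrow> real mat) set \<Rightarrow> (nat \<Rightarrow> real mat) filter" where
  "weights_at_zero N V = (INF \<delta>\<in>{0<..}. principal {H \<in> V. weights_norm N H < \<delta>})"

text \<open>The balls are nested, so the one of radius \<open>min a b\<close> lies in both given
  ones and the infimum of principal filters has the balls as a base.\<close>

lemma eventually_weights_at_zero:
  "eventually P (weights_at_zero N V) \<longleftrightarrow>
     (\<exists>\<delta>>0. \<forall>H\<in>V. weights_norm N H < \<delta> \<longrightarrow> P H)"
proof -
  have "eventually P (weights_at_zero N V) \<longleftrightarrow>
      (\<exists>\<delta>\<in>{0<..}. eventually P (principal {H \<in> V. weights_norm N H < \<delta>}))"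
    unfolding weights_at_zero_def
  proof (rule eventually_INF_base)
    fix a b :: real assume "a \<in> {0<..}" "b \<in> {0<..}"
    then show "\<exists>x\<in>{0<..}. principal {H \<in> V. weights_norm N H < x}
        \<le> inf (principal {H \<in> V. weights_norm N H < a}) (principal {H \<in> V. weights_norm N H < b})"
      by (intro bexI[of _ "min a b"]) auto
  qed auto
  then show ?thesis by (auto simp: eventually_principal)
qed

lemma frobenius_inner_self_nonneg: "0 \<le> frobenius_inner A A"
  by (auto simp: frobenius_inner_def intro!: sum_nonneg)

lemma weights_inner_self_nonneg: "0 \<le> weights_inner N H H"
  by (auto simp: weights_inner_def intro!: sum_nonneg frobenius_inner_self_nonneg)

lemma weights_norm_nonneg: "0 \<le> weights_norm N H"
  by (simp add: weights_norm_def weights_inner_self_nonneg)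

text \<open>The \<epsilon> of the gradient is the constant in little-o and \<delta> is the radius in
  the filter. This turns stationarity into a question of asymptotic calculus.\<close>

lemma has_gradient_iff_smallo:
  "has_gradient N V F W G \<longleftrightarrow>
     (\<lambda>H. F (\<lambda>j. W j + H j) - F W - weights_inner N G H) \<in> o[weights_at_zero N V](weights_norm N)"
  by (simp add: has_gradient_def smallo_def eventually_weights_at_zero weights_norm_nonneg)

lemma weights_norm_tendsto_zero: "(weights_norm N \<longlongrightarrow> 0) (weights_at_zero N V)"
  unfolding tendsto_iff by (auto simp: eventually_weights_at_zero weights_norm_nonneg)

lemma eventually_mem_weights_at_zero: "eventually (\<lambda>H. H \<in> V) (weights_at_zero N V)"
  unfolding eventually_weights_at_zero by (auto intro: exI[of _ 1])

text \<open>The square of an entry is one of the nonnegative summands of the squared norm. Entrywise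
  bounds on a perturbation come from here.\<close>

lemma entry_le_weights_norm:
  assumes "j \<le> N" "a < dim_row (H j)" "b < dim_col (H j)"
  shows "\<bar>H j $$ (a, b)\<bar> \<le> weights_norm N H"
proof -
  have "(H j $$ (a, b))\<^sup>2 \<le> (\<Sum>k<dim_col (H j). H j $$ (a, k) * H j $$ (a, k))"
    using assms member_le_sum[of b "{..<dim_col (H j)}" "\<lambda>k. H j $$ (a, k) * H j $$ (a, k)"]
    by (simp add: power2_eq_square)
  also have "\<dots> \<le> frobenius_inner (H j) (H j)"
    unfolding frobenius_inner_def using assms
    by (intro member_le_sum[of a _ "\<lambda>i. \<Sum>k<dim_col (H j). H j $$ (i, k) * H j $$ (i, k)"])
      (auto intro!: sum_nonneg)
  also have "\<dots> \<le> weights_inner N H H"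
    unfolding weights_inner_def using assms
    by (intro member_le_sum[of j _ "\<lambda>j. frobenius_inner (H j) (H j)"])
      (auto intro: frobenius_inner_self_nonneg)
  finally show ?thesis
    unfolding weights_norm_def by (intro real_le_rsqrt) simp
qed

section \<open>Scalar asymptotics: composition and products\<close>

text \<open>Since \<open>s\<close> tends to 0, \<open>u\<close> eventually enters any neighbourhood
  of \<open>x\<close>, where the first order remainder of \<open>f\<close> is small relative to
  \<open>u - x\<close> and hence relative to \<open>s\<close>.\<close>

lemma has_real_derivative_compose_smallo:
  fixes f :: "real \<Rightarrow> real" and u s :: "'a \<Rightarrow> real"
  assumes f: "(f has_real_derivative D) (at x)"
    and u: "(\<lambda>t. u t - x) \<in> O[F](s)" and s: "(s \<longlongrightarrow> 0) F"
  shows "(\<lambda>t. f (u t) - f x - D * (u t - x)) \<in> o[F](s)"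
proof (rule landau_o.smallI)
  fix c :: real assume "c > 0"
  from u obtain K where "K > 0" and K: "eventually (\<lambda>t. norm (u t - x) \<le> K * norm (s t)) F"
    by (elim landau_o.bigE)
  \<comment> \<open>The tolerance \<open>c / K\<close> compensates the factor \<open>K\<close> lost
    when \<open>u t - x\<close> is replaced by \<open>s t\<close>; likewise the threshold
    \<open>\<delta> / K\<close> for \<open>s\<close> below.\<close>
  have "0 < c / K" using \<open>c > 0\<close> \<open>K > 0\<close> by simp
  with f obtain \<delta> where "\<delta> > 0"
    and \<delta>: "\<And>y. norm (y - x) < \<delta> \<Longrightarrow> norm (f y - f x - D * (y - x)) \<le> c / K * norm (y - x)"
    unfolding has_field_derivative_def has_derivative_at_alt by meson
  have "eventually (\<lambda>t. norm (s t) < \<delta> / K) F"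
    using s \<open>\<delta> > 0\<close> \<open>K > 0\<close> unfolding tendsto_iff by simp
  with K show "eventually (\<lambda>t. norm (f (u t) - f x - D * (u t - x)) \<le> c * norm (s t)) F"
  proof eventually_elim
    case (elim t)
    have "norm (u t - x) < \<delta>"
      using elim \<open>K > 0\<close> by (simp add: field_simps)
    then have "norm (f (u t) - f x - D * (u t - x)) \<le> c / K * norm (u t - x)" by (rule \<delta>)
    also have "\<dots> \<le> c / K * (K * norm (s t))"
      using elim \<open>0 < c / K\<close> by (intro mult_left_mono) auto
    finally show ?case using \<open>K > 0\<close> by simp
  qed
qed

text \<open>The increment of \<open>f\<close> is its first order remainder, which is o(s), plus the
  linear term \<open>D * (u t - x)\<close>, which is O(s).\<close>

lemma differentiable_compose_bigo:
  fixes f :: "real \<Rightarrow> real" and u s :: "'a \<Rightarrow> real"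
  assumes f: "f differentiable (at x)"
    and u: "(\<lambda>t. u t - x) \<in> O[F](s)" and s: "(s \<longlongrightarrow> 0) F"
  shows "(\<lambda>t. f (u t) - f x) \<in> O[F](s)"
proof -
  obtain D where "(f has_real_derivative D) (at x)"
    using f real_differentiable_def by blast
  from has_real_derivative_compose_smallo[OF this u s]
  have "(\<lambda>t. f (u t) - f x - D * (u t - x)) \<in> O[F](s)" by (rule landau_o.small_imp_big)
  \<comment> \<open>A constant factor can be cancelled in big-O only if it is nonzero, hence the
    case split.\<close>
  moreover have "(\<lambda>t. D * (u t - x)) \<in> O[F](s)" using u by (cases "D = 0") auto
  ultimately have "(\<lambda>t. (f (u t) - f x - D * (u t - x)) + D * (u t - x)) \<in> O[F](s)"
    by (rule sum_in_bigo)
  then show ?thesis by simp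
qed

lemma tendsto_zero_imp_bigo_1:
  fixes s :: "'a \<Rightarrow> real"
  assumes "(s \<longlongrightarrow> 0) F"
  shows "s \<in> O[F](\<lambda>_. 1)"
  using assms by (auto intro: bigoI_tendsto)

lemma index_mult_mat_sum:
  assumes "A \<in> carrier_mat p q" "B \<in> carrier_mat q d" "i < p" "l < d"
  shows "(A * B) $$ (i, l) = (\<Sum>k<q. A $$ (i, k) * B $$ (k, l))"
  using assms by (auto simp: scalar_prod_def atLeast0LessThan intro!: sum.cong)

text \<open>The identity is fg - ab = (f - a)(g - b) + b(f - a) + a(g - b). The first product is
  O(s) because \<open>s\<close> tends to 0, which makes one of its factors bounded.\<close>

lemma mult_diff_bigo:
  fixes f g s :: "'a \<Rightarrow> real"
  assumes f: "(\<lambda>t. f t - a) \<in> O[F](s)" and g: "(\<lambda>t. g t - b) \<in> O[F](s)"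
    and s: "(s \<longlongrightarrow> 0) F"
  shows "(\<lambda>t. f t * g t - a * b) \<in> O[F](s)"
proof -
  have "(\<lambda>t. g t - b) \<in> O[F](\<lambda>_. 1)"
    using g tendsto_zero_imp_bigo_1[OF s] by (rule landau_o.big_trans)
  with f have "(\<lambda>t. (f t - a) * (g t - b)) \<in> O[F](\<lambda>t. s t * 1)"
    by (rule landau_o.big.mult)
  moreover have "(\<lambda>t. b * (f t - a)) \<in> O[F](s)" using f by (cases "b = 0") auto
  moreover have "(\<lambda>t. a * (g t - b)) \<in> O[F](s)" using g by (cases "a = 0") auto
  ultimately have "(\<lambda>t. (f t - a) * (g t - b) + b * (f t - a) + a * (g t - b)) \<in> O[F](s)"
    by (intro sum_in_bigo) simp_all
  then show ?thesis by (simp add: algebra_simps)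
qed

section \<open>Perturbation of matrix products and of hidden layers\<close>

text \<open>An entry of a product is a finite sum of scalar products, so
  \<open>mult_diff_bigo\<close> applies to each summand. Shapes are only required eventually, since
  perturbations have the right ones only inside the weight space.\<close>

lemma mult_mat_diff_bigo:
  fixes A B :: "'a \<Rightarrow> real mat" and s :: "'a \<Rightarrow> real"
  assumes A: "eventually (\<lambda>t. A t \<in> carrier_mat p q) F" and A0: "A\<^sub>0 \<in> carrier_mat p q"
    and B: "eventually (\<lambda>t. B t \<in> carrier_mat q d) F" and B0: "B\<^sub>0 \<in> carrier_mat q d"
    and dA: "\<And>k. k < q \<Longrightarrow> (\<lambda>t. A t $$ (i, k) - A\<^sub>0 $$ (i, k)) \<in> O[F](s)"
    and dB: "\<And>k. k < q \<Longrightarrow> (\<lambda>t. B t $$ (k, l) - B\<^sub>0 $$ (k, l)) \<in> O[F](s)"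
    and s: "(s \<longlongrightarrow> 0) F" and i: "i < p" and l: "l < d"
  shows "(\<lambda>t. (A t * B t) $$ (i, l) - (A\<^sub>0 * B\<^sub>0) $$ (i, l)) \<in> O[F](s)"
proof -
  have "(\<lambda>t. \<Sum>k<q. A t $$ (i, k) * B t $$ (k, l) - A\<^sub>0 $$ (i, k) * B\<^sub>0 $$ (k, l)) \<in> O[F](s)"
    by (intro big_sum_in_bigo mult_diff_bigo dA dB s) auto
  moreover have "eventually (\<lambda>t. (A t * B t) $$ (i, l) - (A\<^sub>0 * B\<^sub>0) $$ (i, l)
      = (\<Sum>k<q. A t $$ (i, k) * B t $$ (k, l) - A\<^sub>0 $$ (i, k) * B\<^sub>0 $$ (k, l))) F"
    using A B
  proof eventually_elim
    case (elim t)
    show ?case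
      by (simp only: index_mult_mat_sum[OF elim i l] index_mult_mat_sum[OF A0 B0 i l] sum_subtractf)
  qed
  ultimately show ?thesis by (simp cong: landau_o.big.in_cong)
qed

lemma weight_space_carrier:
  assumes "W \<in> weight_space N n m r"
  shows "W 0 \<in> carrier_mat (r 0) n"
    and "Suc j < N \<Longrightarrow> W (Suc j) \<in> carrier_mat (r (Suc j)) (r j)"
    and "W N \<in> carrier_mat m (r (N - 1))"
proof -
  show "W 0 \<in> carrier_mat (r 0) n" and "W N \<in> carrier_mat m (r (N - 1))"
    using assms by (simp_all add: weight_space_def)
  show "W (Suc j) \<in> carrier_mat (r (Suc j)) (r j)" if "Suc j < N"
  proof -
    have "Suc j \<in> {1..N-1}" using that by auto
    with assms have "W (Suc j) \<in> carrier_mat (r (Suc j)) (r (Suc j - 1))"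
      unfolding weight_space_def by blast
    then show ?thesis by simp
  qed
qed

lemma weight_space_add:
  assumes "W \<in> weight_space N n m r" "H \<in> weight_space N n m r"
  shows "(\<lambda>j. W j + H j) \<in> weight_space N n m r"
  using assms unfolding weight_space_def by auto

lemma pre_activation_carrier:
  assumes W: "W \<in> weight_space N n m r" and X: "X \<in> carrier_mat n d" and "j < N"
  shows "pre_activation \<sigma> X W j \<in> carrier_mat (r j) d"
  using \<open>j < N\<close>
proof (induction j)
  case 0
  then show ?case using weight_space_carrier(1)[OF W] X by simp
next
  case (Suc j)
  then show ?case using weight_space_carrier(2)[OF W Suc.prems]
    by simp
qed

text \<open>Induction on the layer: a differentiable activation and a product with perturbed weights
  both preserve O(s). The row \<open>i\<close> is generalised because an entry of the next layer
  involves the whole column \<open>l\<close> of the previous one.\<close>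

lemma pre_activation_diff_bigo:
  fixes U :: "'a \<Rightarrow> nat \<Rightarrow> real mat" and s :: "'a \<Rightarrow> real"
  assumes W: "W \<in> weight_space N n m r" and X: "X \<in> carrier_mat n d"
    and U: "eventually (\<lambda>t. U t \<in> weight_space N n m r) F"
    and dU: "\<And>j a b. j < N \<Longrightarrow> a < dim_row (W j) \<Longrightarrow> b < dim_col (W j) \<Longrightarrow>
        (\<lambda>t. U t j $$ (a, b) - W j $$ (a, b)) \<in> O[F](s)"
    and \<sigma>: "\<And>j x. 1 \<le> j \<Longrightarrow> j < N \<Longrightarrow> \<sigma> j differentiable (at x)"
    and s: "(s \<longlongrightarrow> 0) F"
    and "j < N" "i < r j" "l < d"
  shows "(\<lambda>t. pre_activation \<sigma> X (U t) j $$ (i, l) - pre_activation \<sigma> X W j $$ (i, l)) \<in> O[F](s)"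
  using \<open>j < N\<close> \<open>i < r j\<close>
proof (induction j arbitrary: i)
  case 0
  note W0 = weight_space_carrier(1)[OF W]
  have U0: "eventually (\<lambda>t. U t 0 \<in> carrier_mat (r 0) n) F"
    using U by eventually_elim (rule weight_space_carrier(1))
  show ?case unfolding pre_activation.simps
  proof (rule mult_mat_diff_bigo[OF U0 W0 _ X _ _ s \<open>i < r 0\<close> \<open>l < d\<close>])
    show "(\<lambda>t. U t 0 $$ (i, k) - W 0 $$ (i, k)) \<in> O[F](s)" if "k < n" for k
      using W0 0 that by (intro dU) auto
  \<comment> \<open>The input \<open>X\<close> is not perturbed, so its entries contribute the
    difference 0.\<close>
  qed (use X in simp_all)
next
  case (Suc j)
  note WS = weight_space_carrier(2)[OF W Suc.prems(1)]
  have US: "eventually (\<lambda>t. U t (Suc j) \<in> carrier_mat (r (Suc j)) (r j)) F"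
    using U by eventually_elim (rule weight_space_carrier(2)[OF _ Suc.prems(1)])
  have "j < N" using Suc.prems by simp
  note P = pre_activation_carrier[OF W X \<open>j < N\<close>, of \<sigma>]
  have PU: "eventually (\<lambda>t. pre_activation \<sigma> X (U t) j \<in> carrier_mat (r j) d) F"
    using U by eventually_elim (rule pre_activation_carrier[OF _ X \<open>j < N\<close>])
  show ?case unfolding pre_activation.simps
  proof (rule mult_mat_diff_bigo[OF US WS _ _ _ _ s \<open>i < r (Suc j)\<close> \<open>l < d\<close>])
    show "map_mat (\<sigma> (Suc j)) (pre_activation \<sigma> X W j) \<in> carrier_mat (r j) d"
      using P by simp
    show "eventually (\<lambda>t. map_mat (\<sigma> (Suc j)) (pre_activation \<sigma> X (U t) j) \<in> carrier_mat (r j) d) F"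
      using PU by simp
    show "(\<lambda>t. U t (Suc j) $$ (i, k) - W (Suc j) $$ (i, k)) \<in> O[F](s)" if "k < r j" for k
      using WS Suc.prems that by (intro dU) auto
  next
    fix k assume k: "k < r j"
    have "(\<lambda>t. \<sigma> (Suc j) (pre_activation \<sigma> X (U t) j $$ (k, l))
        - \<sigma> (Suc j) (pre_activation \<sigma> X W j $$ (k, l))) \<in> O[F](s)"
      using Suc.prems by (intro differentiable_compose_bigo[OF \<sigma> Suc.IH[OF \<open>j < N\<close> k] s]) auto
    moreover have "eventually (\<lambda>t.
        map_mat (\<sigma> (Suc j)) (pre_activation \<sigma> X (U t) j) $$ (k, l)
          - map_mat (\<sigma> (Suc j)) (pre_activation \<sigma> X W j) $$ (k, l)
        = \<sigma> (Suc j) (pre_activation \<sigma> X (U t) j $$ (k, l))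
          - \<sigma> (Suc j) (pre_activation \<sigma> X W j $$ (k, l))) F"
      using PU by eventually_elim (use P k \<open>l < d\<close> in auto)
    ultimately show "(\<lambda>t. map_mat (\<sigma> (Suc j)) (pre_activation \<sigma> X (U t) j) $$ (k, l)
          - map_mat (\<sigma> (Suc j)) (pre_activation \<sigma> X W j) $$ (k, l)) \<in> O[F](s)"
      by (subst landau_o.big.in_cong)
  qed
qed

section \<open>Vanishing of the first order change of the loss\<close>

theorem corollary4p1:
  fixes N n d m :: nat and r :: "nat \<Rightarrow> nat"
    and X Y :: "real mat" and \<sigma> :: "nat \<Rightarrow> real \<Rightarrow> real" and W :: "nat \<Rightarrow> real mat"
  assumes "1 \<le> N"
    and "X \<in> carrier_mat n d" and "Y \<in> carrier_mat m d"
    and "\<And>j x. 1 \<le> j \<Longrightarrow> j \<le> N \<Longrightarrow> \<sigma> j differentiable (at x)"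
    and "W 0 \<in> carrier_mat (r 0) n"
    and "\<And>j. 1 \<le> j \<Longrightarrow> j \<le> N - 1 \<Longrightarrow> W j \<in> carrier_mat (r j) (r (j - 1))"
    and "map_mat (\<sigma> N) (pre_activation \<sigma> X W (N - 1)) = 0\<^sub>m (r (N - 1)) d"
    and "map_mat (deriv (\<sigma> N)) (pre_activation \<sigma> X W (N - 1)) = 0\<^sub>m (r (N - 1)) d"
  shows "\<forall>W\<^sub>N \<in> carrier_mat m (r (N - 1)).
    first_order_stationary N (weight_space N n m r) (network_loss N \<sigma> X Y) (W(N := W\<^sub>N))"
proof
  fix W\<^sub>N :: "real mat" assume WN: "W\<^sub>N \<in> carrier_mat m (r (N - 1))"
  define V where "V = weight_space N n m r"
  define W' where "W' = W(N := W\<^sub>N)"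
  define F where "F = weights_at_zero N V"
  define s where "s = weights_norm N"
  \<comment> \<open>For a perturbation \<open>H\<close>: \<open>U H\<close> are the perturbed
    weights, \<open>P H\<close> is the argument of the last activation, \<open>A H\<close> the last
    hidden layer and \<open>R H\<close> the network output.\<close>
  define U where "U = (\<lambda>H j. W' j + H j)"
  define P where "P = (\<lambda>H. pre_activation \<sigma> X (U H) (N - 1))"
  define P\<^sub>0 where "P\<^sub>0 = pre_activation \<sigma> X W' (N - 1)"
  define A where "A = (\<lambda>H. map_mat (\<sigma> N) (P H))"
  define R where "R = (\<lambda>H. U H N * A H)"
  note X = \<open>X \<in> carrier_mat n d\<close> and Y = \<open>Y \<in> carrier_mat m d\<close>
  have N1: "N - 1 < N" using \<open>1 \<le> N\<close> by simp
  have W': "W' \<in> V"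
    using assms(1,5,6) WN by (auto simp: V_def W'_def weight_space_def)
  have W'N: "W' N \<in> carrier_mat m (r (N - 1))" using WN by (simp add: W'_def)
  have s0: "(s \<longlongrightarrow> 0) F" unfolding s_def F_def by (rule weights_norm_tendsto_zero)
  have HV: "eventually (\<lambda>H. H \<in> V) F" unfolding F_def by (rule eventually_mem_weights_at_zero)
  have UV: "U H \<in> V" if "H \<in> V" for H
    using weight_space_add W' that unfolding V_def U_def by blast
  have dims: "dim_row (H j) = dim_row (W' j) \<and> dim_col (H j) = dim_col (W' j)"
    if "H \<in> V" "j \<le> N" for H j
  proof -
    \<comment> \<open>The cases mirror the three clauses of \<open>weight_space\<close>.\<close>
    consider "j = 0" | "j = N" | "j \<in> {1..N-1}" using \<open>j \<le> N\<close> by (cases "j = 0"; cases "j = N") auto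
    then have "\<exists>p q. H j \<in> carrier_mat p q \<and> W' j \<in> carrier_mat p q"
      using W' \<open>H \<in> V\<close> unfolding V_def weight_space_def by cases blast+
    then show ?thesis by auto
  qed
  have dU: "(\<lambda>H. U H j $$ (a, b) - W' j $$ (a, b)) \<in> O[F](s)"
    if "j \<le> N" "a < dim_row (W' j)" "b < dim_col (W' j)" for j a b
  proof (rule landau_o.bigI[of 1])
    show "eventually (\<lambda>H. norm (U H j $$ (a, b) - W' j $$ (a, b)) \<le> 1 * norm (s H)) F"
      using HV
    proof eventually_elim
      case (elim H)
      show ?case
        using entry_le_weights_norm[OF \<open>j \<le> N\<close>, of a H b] dims[OF elim \<open>j \<le> N\<close>] that
        by (simp add: U_def s_def)
    qed
  qed simp
  \<comment> \<open>Layers below \<open>N\<close> do not see the output weights, so the two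
    vanishing conditions carry over from \<open>W\<close> to \<open>W'\<close>.\<close>
  have pre: "pre_activation \<sigma> X W j = pre_activation \<sigma> X W' j" if "j < N" for j
    using that by (induction j) (simp_all add: W'_def)
  have P0: "P\<^sub>0 \<in> carrier_mat (r (N - 1)) d"
    unfolding P\<^sub>0_def using W' X N1 unfolding V_def by (rule pre_activation_carrier)
  have P: "P H \<in> carrier_mat (r (N - 1)) d" if "H \<in> V" for H
    unfolding P_def using UV[OF that] X N1 unfolding V_def by (rule pre_activation_carrier)
  have dP: "(\<lambda>H. P H $$ (k, l) - P\<^sub>0 $$ (k, l)) \<in> O[F](s)" if "k < r (N - 1)" "l < d" for k l
    unfolding P_def P\<^sub>0_def
  proof (rule pre_activation_diff_bigo[OF W'[unfolded V_def] X _ _ _ s0 N1 that])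
    show "eventually (\<lambda>H. U H \<in> weight_space N n m r) F"
      using HV by eventually_elim (use UV in \<open>simp add: V_def\<close>)
    show "\<sigma> j differentiable (at x)" if "1 \<le> j" "j < N" for j x
      using assms(4) that by simp
  qed (use dU in simp)
  have dA: "(\<lambda>H. A H $$ (k, l)) \<in> o[F](s)" if kl: "k < r (N - 1)" "l < d" for k l
  proof -
    have "map_mat (\<sigma> N) P\<^sub>0 $$ (k, l) = 0" "map_mat (deriv (\<sigma> N)) P\<^sub>0 $$ (k, l) = 0"
      using assms(7,8) pre[OF N1] kl by (simp_all add: P\<^sub>0_def)
    then have z: "\<sigma> N (P\<^sub>0 $$ (k, l)) = 0" "deriv (\<sigma> N) (P\<^sub>0 $$ (k, l)) = 0"
      using P0 kl by auto
    \<comment> \<open>Differentiability is what lets the value 0 of \<open>deriv\<close> be read as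
      an actual derivative.\<close>
    have "(\<sigma> N has_real_derivative 0) (at (P\<^sub>0 $$ (k, l)))"
      using assms(4)[of N "P\<^sub>0 $$ (k, l)"] \<open>1 \<le> N\<close> z(2)
      by (metis DERIV_imp_deriv order_refl real_differentiable_def)
    \<comment> \<open>As value and slope are both 0 at the base point, the first order remainder is
      the activated entry itself.\<close>
    from has_real_derivative_compose_smallo[OF this dP[OF kl] s0]
    have "(\<lambda>H. \<sigma> N (P H $$ (k, l))) \<in> o[F](s)" by (simp add: z)
    moreover have "eventually (\<lambda>H. A H $$ (k, l) = \<sigma> N (P H $$ (k, l))) F"
      using HV
    proof eventually_elim
      case (elim H)
      show ?case using P[OF elim] kl by (simp add: A_def)
    qed
    ultimately show ?thesis by (subst landau_o.small.in_cong)
  qed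
  have A: "A H \<in> carrier_mat (r (N - 1)) d" if "H \<in> V" for H
    using P[OF that] by (simp add: A_def)
  have UN: "U H N \<in> carrier_mat m (r (N - 1))" if "H \<in> V" for H
    using UV[OF that] unfolding V_def by (rule weight_space_carrier(3))
  have dR: "(\<lambda>H. R H $$ (i, l)) \<in> o[F](s)" if il: "i < m" "l < d" for i l
  proof -
    have "(\<lambda>H. U H N $$ (i, k) * A H $$ (k, l)) \<in> o[F](s)" if k: "k < r (N - 1)" for k
    proof -
      \<comment> \<open>The perturbed output weights stay bounded, and a bounded factor times o(s)
        is o(s).\<close>
      have "(\<lambda>H. U H N $$ (i, k) - W' N $$ (i, k)) \<in> O[F](\<lambda>_. 1)"
        using dU[of N i k] tendsto_zero_imp_bigo_1[OF s0] W'N il k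
        by (auto intro: landau_o.big_trans)
      then have "(\<lambda>H. (U H N $$ (i, k) - W' N $$ (i, k)) + W' N $$ (i, k)) \<in> O[F](\<lambda>_. 1)"
        by (rule sum_in_bigo) simp
      from landau_o.big_small_mult[OF this dA[OF k il(2)]] show ?thesis by simp
    qed
    then have "(\<lambda>H. \<Sum>k<r (N - 1). U H N $$ (i, k) * A H $$ (k, l)) \<in> o[F](s)"
      by (intro big_sum_in_smallo) auto
    moreover have "eventually (\<lambda>H. R H $$ (i, l)
        = (\<Sum>k<r (N - 1). U H N $$ (i, k) * A H $$ (k, l))) F"
      using HV by eventually_elim (unfold R_def, rule index_mult_mat_sum[OF UN A il])
    ultimately show ?thesis by (subst landau_o.small.in_cong)
  qed
  have loss: "network_loss N \<sigma> X Y (U H) = 1/2 * (\<Sum>i<m. \<Sum>l<d. (Y $$ (i, l) - R H $$ (i, l))\<^sup>2)"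
    if "H \<in> V" for H
  proof -
    have "R H \<in> carrier_mat m d" unfolding R_def using UN A that by (meson mult_carrier_mat)
    moreover have "network_loss N \<sigma> X Y (U H) = 1/2 * (frobenius_norm (Y - R H))\<^sup>2"
      by (simp add: network_loss_def R_def A_def P_def)
    ultimately show ?thesis using Y
      by (simp add: frobenius_norm_def sum_nonneg)
  qed
  \<comment> \<open>At the base point the last hidden layer is 0, so the residual is
    \<open>Y\<close> whatever \<open>W\<^sub>N\<close> is.\<close>
  have loss0: "network_loss N \<sigma> X Y W' = 1/2 * (\<Sum>i<m. \<Sum>l<d. (Y $$ (i, l))\<^sup>2)"
  proof -
    have "W' N * map_mat (\<sigma> N) P\<^sub>0 = 0\<^sub>m m d"
      using assms(7) pre[OF N1] W'N by (simp add: P\<^sub>0_def)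
    then show ?thesis using Y
      by (simp add: network_loss_def P\<^sub>0_def frobenius_norm_def sum_nonneg)
  qed
  \<comment> \<open>This is the entrywise change of the loss: half of (y - r)^2 - y^2 equals r(r/2 -
    y), with \<open>r\<close> being o(s) and the other factor bounded.\<close>
  have "(\<lambda>H. R H $$ (i, l) * (1/2 * R H $$ (i, l) - Y $$ (i, l))) \<in> o[F](s)"
    if il: "i < m" "l < d" for i l
  proof -
    have "(\<lambda>H. R H $$ (i, l)) \<in> O[F](\<lambda>_. 1)"
      using landau_o.small_imp_big[OF dR[OF il]] tendsto_zero_imp_bigo_1[OF s0]
      by (rule landau_o.big_trans)
    then have "(\<lambda>H. 1/2 * R H $$ (i, l) - Y $$ (i, l)) \<in> O[F](\<lambda>_. 1)"
      by (intro sum_in_bigo) auto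
    from landau_o.small_big_mult[OF dR[OF il] this] show ?thesis by simp
  qed
  then have "(\<lambda>H. \<Sum>i<m. \<Sum>l<d. R H $$ (i, l) * (1/2 * R H $$ (i, l) - Y $$ (i, l))) \<in> o[F](s)"
    by (intro big_sum_in_smallo) auto
  moreover have "eventually (\<lambda>H. network_loss N \<sigma> X Y (U H) - network_loss N \<sigma> X Y W'
      = (\<Sum>i<m. \<Sum>l<d. R H $$ (i, l) * (1/2 * R H $$ (i, l) - Y $$ (i, l)))) F"
    using HV
  proof eventually_elim
    case (elim H)
    show ?case
      unfolding loss[OF elim] loss0 sum_distrib_left sum_subtractf[symmetric]
      by (intro sum.cong refl) (simp add: power2_eq_square algebra_simps)
  qed
  ultimately have small: "(\<lambda>H. network_loss N \<sigma> X Y (U H) - network_loss N \<sigma> X Y W') \<in> o[F](s)"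
    by (subst landau_o.small.in_cong)
  \<comment> \<open>For the candidate gradient 0 the linear term disappears, so the remainder to be
    bounded is the loss difference in \<open>small\<close>.\<close>
  have inner: "weights_inner N (\<lambda>j. 0\<^sub>m (dim_row (W' j)) (dim_col (W' j))) H = 0" for H
    by (simp add: weights_inner_def frobenius_inner_def)
  have "has_gradient N V (network_loss N \<sigma> X Y) W' (\<lambda>j. 0\<^sub>m (dim_row (W' j)) (dim_col (W' j)))"
    unfolding has_gradient_iff_smallo inner using small by (simp add: U_def F_def s_def)
  then show "first_order_stationary N (weight_space N n m r) (network_loss N \<sigma> X Y) (W(N := W\<^sub>N))"
    using W' unfolding first_order_stationary_def V_def W'_def by simp
qed

end
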